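(* For every integer $n\ge1$, the hybrid Fibonacci spinors $FSH_n$ and hybrid Lucas spinors $LSH_n$ satisfy: (i) $L_{n+1}\,FSH_n+L_n\,FSH_{n-1}=LSH_{2n}$; (ii) $F_{n+1}\,FSH_n+F_n\,FSH_{n-1}=FSH_{2n}$.
   Context: $h$ is the hyperbolic unit: $h^2=1$, $h\notin\mathbb{R}$, so entries lie in the commutative ring of hyperbolic (split-complex) numbers $\{a+hb: a,b\in\mathbb{R}\}\cong\mathbb{R}[h]/(h^2-1)$. $F_n$ is the Fibonacci sequence ($F_0=0$, $F_1=1$, $F_{n+1}=F_n+F_{n-1}$) and $L_n$ is the Lucas sequence ($L_0=2$, $L_1=1$, $L_{n+1}=L_n+L_{n-1}$). For $n\ge0$ the $n$th hybrid Fibonacci and Lucas spinors are the column vectors $$FSH_n=\begin{bmatrix}F_n+hF_{n+2}\\ (F_{n+2}-F_{n+1})+hF_{n+3}\end{bmatrix},\qquad LSH_n=\begin{bmatrix}L_n+hL_{n+2}\\ L_n+hL_{n+3}\end{bmatrix}.$$ *)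

theory Defs
  imports "HOL-Analysis.Cartesian_Space" "HOL-Number_Theory.Fib"
begin

text \<open>The hyperbolic (split-complex) numbers: \<open>Hyp a b\<close> stands for \<open>a + h b\<close> with \<open>h\<^sup>2 = 1\<close>.\<close>

datatype hyperbolic = Hyp (hre: real) (him: real)

instantiation hyperbolic :: comm_ring_1
begin

definition zero_hyperbolic where "0 = Hyp 0 0"
definition one_hyperbolic where "1 = Hyp 1 0"
definition plus_hyperbolic where "x + y = Hyp (hre x + hre y) (him x + him y)"
definition uminus_hyperbolic where "- x = Hyp (- hre x) (- him x)"
definition minus_hyperbolic where "x - y = Hyp (hre x - hre y) (him x - him y)"
definition times_hyperbolic where
  "x * y = Hyp (hre x * hre y + him x * him y) (hre x * him y + him x * hre y)"

instance
  by standard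
    (simp_all add: zero_hyperbolic_def one_hyperbolic_def plus_hyperbolic_def
      uminus_hyperbolic_def minus_hyperbolic_def times_hyperbolic_def hyperbolic.expand algebra_simps)

end

instantiation hyperbolic :: real_algebra_1
begin

definition scaleR_hyperbolic where "r *\<^sub>R x = Hyp (r * hre x) (r * him x)"

instance
  by standard
    (simp_all add: scaleR_hyperbolic_def plus_hyperbolic_def times_hyperbolic_def algebra_simps)

end

definition h :: hyperbolic where "h = Hyp 0 1"

lemma h_squared: "h ^ 2 = 1"
  by (simp add: h_def power2_eq_square times_hyperbolic_def one_hyperbolic_def)

lemma h_not_real: "h \<notin> \<real>"
  by (auto simp: Reals_def of_real_def h_def scaleR_hyperbolic_def one_hyperbolic_def)

lemma Hyp_eq: "Hyp a b = of_real a + h * of_real b"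
  by (simp add: of_real_def h_def scaleR_hyperbolic_def one_hyperbolic_def
      plus_hyperbolic_def times_hyperbolic_def)

fun lucas :: "nat \<Rightarrow> nat" where
  "lucas 0 = 2"
| "lucas (Suc 0) = 1"
| "lucas (Suc (Suc n)) = lucas (Suc n) + lucas n"

definition FSH :: "nat \<Rightarrow> hyperbolic ^ 2" where
  "FSH n = vector
     [of_nat (fib n) + h * of_nat (fib (n + 2)),
      (of_nat (fib (n + 2)) - of_nat (fib (n + 1))) + h * of_nat (fib (n + 3))]"

definition LSH :: "nat \<Rightarrow> hyperbolic ^ 2" where
  "LSH n = vector
     [of_nat (lucas n) + h * of_nat (lucas (n + 2)),
      of_nat (lucas n) + h * of_nat (lucas (n + 3))]"

end

theory Submission
  imports Defs
begin

text \<open>Every entry is a pair of sequence terms with index shifts 0 and 2, or 0 and 3, so both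
  claims reduce coefficientwise to the addition formulas \<open>lucas_add\<close> and
  \<open>fib_add\<close>, taken where the two indices sum to \<open>2 * n - 1 + j\<close> with
  \<open>j\<close> the shift.\<close>

lemma lucas_add: "lucas (Suc (n + k)) = lucas (Suc n) * fib (Suc k) + lucas n * fib k"
  by (induction k rule: fib.induct) (auto simp: algebra_simps)

text \<open>By the Fibonacci recurrence; this gives \<open>FSH\<close> the same shape as
  \<open>LSH\<close>, so one argument serves both.\<close>

lemma FSH_eq:
  "FSH n = vector [of_nat (fib n) + h * of_nat (fib (n + 2)),
                   of_nat (fib n) + h * of_nat (fib (n + 3))]"
  by (simp add: FSH_def)

text \<open>Splits an identity between entries into two identities over \<open>nat\<close>, one for
  each coefficient.\<close>

lemma of_nat_combination:
  fixes x :: "'a::comm_semiring_1"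
  assumes "r = a * p + b * q" and "r' = a * p' + b * q'"
  shows "of_nat a * (of_nat p + x * of_nat p') + of_nat b * (of_nat q + x * of_nat q') =
         of_nat r + x * of_nat r'"
  by (simp add: assms algebra_simps)

theorem theorem4p9:
  fixes n :: nat
  assumes "n \<ge> 1"
  shows "of_nat (lucas (n + 1)) *s FSH n + of_nat (lucas n) *s FSH (n - 1) = LSH (2 * n) \<and>
         of_nat (fib (n + 1)) *s FSH n + of_nat (fib n) *s FSH (n - 1) = FSH (2 * n)"
proof -
  obtain m where n: "n = Suc m"
    using assms by (cases n) auto
  \<comment> \<open>With \<open>n = Suc m\<close>, \<open>Suc (n + (m + j))\<close> is
    \<open>2 * n + j\<close>.\<close>
  have L: "lucas (2 * n + j) = lucas (n + 1) * fib (n + j) + lucas n * fib (n - 1 + j)" for j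
    using lucas_add[of n "m + j"] by (simp add: n mult_2 add.assoc)
  have F: "fib (2 * n + j) = fib (n + 1) * fib (n + j) + fib n * fib (n - 1 + j)" for j
    using fib_add[of "m + j" n] by (simp add: n mult_2 mult_2_right ac_simps)
  show ?thesis
    unfolding vec_eq_iff forall_2 FSH_eq LSH_def vector_add_component vector_smult_component vector_2
    \<comment> \<open>The shifts \<open>j = 2\<close> and \<open>j = 3\<close> match by unification;
      \<open>j = 0\<close> needs its \<open>+ 0\<close> removed first.\<close>
    by (intro conjI of_nat_combination L F L[of 0, simplified add_0_right] F[of 0, simplified add_0_right])
qed

end
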